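(* Let $\dot{\boldsymbol{x}}=\boldsymbol{f}(\boldsymbol{x})$ be an autonomous polynomial ODE in $\mathbb{R}^n$ possessing an affine Darboux polynomial $p(\boldsymbol{x})$ (with coefficients in $\mathbb{K}=\mathbb{R}$ or $\mathbb{C}$) with a constant cofactor $\lambda\in\mathbb{K}$, i.e. $\boldsymbol{f}(\boldsymbol{x})^T\nabla p(\boldsymbol{x})=\lambda p(\boldsymbol{x})$. Then the map $\varphi_h$ of any $s$-stage Runge-Kutta method with coefficients $\mathcal{A}\in\mathbb{R}^{s\times s}$, $\boldsymbol{b}\in\mathbb{R}^s$ and stability function $R(z)$ satisfies $$p(\varphi_h(\boldsymbol{x}))=R(\lambda h)\,p(\boldsymbol{x}),$$ where $$R(z)=1+z\,\boldsymbol{b}^T(I-z\mathcal{A})^{-1}\mathbb{1}$$ is the (constant) discrete cofactor, $\mathbb{1}\in\mathbb{R}^s$ is the vector of ones and $I$ is the $s\times s$ identity matrix.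
   Context: An $s$-stage Runge-Kutta method with coefficients $\mathcal{A}=[a_{ij}]$, $\boldsymbol{b}=(b_1,\dots,b_s)^T$ and time step $h$ applied to $\dot{\boldsymbol{x}}=\boldsymbol{f}(\boldsymbol{x})$ defines the map $\varphi_h$ by $$\boldsymbol{g}_i=\boldsymbol{x}+h\sum_{j=1}^s a_{ij}\boldsymbol{f}(\boldsymbol{g}_j)\quad(i=1,\dots,s),\qquad \varphi_h(\boldsymbol{x})=\boldsymbol{x}+h\sum_{j=1}^s b_j\boldsymbol{f}(\boldsymbol{g}_j).$$ Convention: for each $\boldsymbol{x}$, $|h|$ is taken sufficiently small (depending on $\boldsymbol{x}$), the stages are the solution of the stage equations near $\boldsymbol{x}$ (with $\boldsymbol{g}_i\to\boldsymbol{x}$ as $h\to0$), and $I-\lambda h\mathcal{A}$ is invertible. *)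

theory Defs
  imports "HOL-Analysis.Analysis"
begin

(* Scalars: the coefficient field K (real or complex) is rendered as a type 'k :: real_normed_field.
   Its instances are, by Gelfand-Mazur, isomorphic to the real or the complex numbers.
   Points stay real, and real data are embedded in 'k by of_real. *)

definition gradient :: "(real^'n \<Rightarrow> 'k::real_normed_field) \<Rightarrow> real^'n \<Rightarrow> 'k^'n" where
  "gradient p x = (\<chi> i. frechet_derivative p (at x) (axis i 1))"

definition affine_polynomial :: "(real^'n \<Rightarrow> 'k::real_normed_field) \<Rightarrow> bool" where
  "affine_polynomial p \<longleftrightarrow> (\<exists>a d. \<forall>x. p x = a + (\<Sum>i\<in>UNIV. d $ i * of_real (x $ i)))"

definition darboux_polynomial ::
  "(real^'n \<Rightarrow> real^'n) \<Rightarrow> (real^'n \<Rightarrow> 'k::real_normed_field) \<Rightarrow> (real^'n \<Rightarrow> 'k) \<Rightarrow> bool" where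
  "darboux_polynomial f c p \<longleftrightarrow>
     polynomial_function p \<and> polynomial_function c \<and>
     (\<forall>x. (\<Sum>i\<in>UNIV. of_real (f x $ i) * gradient p x $ i) = c x * p x)"

definition rk_matrix :: "real^'s^'s \<Rightarrow> 'k::real_normed_field \<Rightarrow> 'k^'s^'s" where
  "rk_matrix A z = mat 1 - map_matrix (\<lambda>a. z * of_real a) A"

definition stability_function ::
  "real^'s^'s \<Rightarrow> real^'s \<Rightarrow> 'k::real_normed_field \<Rightarrow> 'k" where
  "stability_function A b z =
     1 + z * (\<Sum>i\<in>UNIV. of_real (b $ i) * (matrix_inv (rk_matrix A z) *v vec 1) $ i)"

definition rk_stages ::
  "real^'s^'s \<Rightarrow> (real^'n \<Rightarrow> real^'n) \<Rightarrow> real \<Rightarrow> real^'n \<Rightarrow> ('s \<Rightarrow> real^'n) \<Rightarrow> bool" where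
  "rk_stages A f h x g \<longleftrightarrow> (\<forall>i. g i = x + h *\<^sub>R (\<Sum>j\<in>UNIV. A $ i $ j *\<^sub>R f (g j)))"

(* The map phi h of an implicit method is only defined for step sizes that are small depending on
   the point; here its domain is given by abs h < \<delta> x. The limit condition selects the
   solution branch of the stage equations that starts at x. Values of phi outside the domain are
   unconstrained. *)
definition is_rk_map ::
  "real^'s^'s \<Rightarrow> real^'s \<Rightarrow> (real^'n \<Rightarrow> real^'n) \<Rightarrow> (real^'n \<Rightarrow> real) \<Rightarrow> (real \<Rightarrow> real^'n \<Rightarrow> real^'n) \<Rightarrow> bool"
  where
  "is_rk_map A b f \<delta> \<phi> \<longleftrightarrow>
     (\<forall>x. \<delta> x > 0) \<and>
     (\<exists>g. (\<forall>x i. ((\<lambda>h. g h x i) \<longlongrightarrow> x) (at 0)) \<and>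
          (\<forall>x h. \<bar>h\<bar> < \<delta> x \<longrightarrow>
             rk_stages A f h x (g h x) \<and>
             \<phi> h x = x + h *\<^sub>R (\<Sum>j\<in>UNIV. b $ j *\<^sub>R f (g h x j))))"

lemma rk_stages_local:
  fixes f :: "real^'n \<Rightarrow> real^'n" and A :: "real^'s^'s" and x :: "real^'n"
  assumes f: "continuous_on UNIV f"
  shows "\<exists>d>0. \<exists>g. (\<forall>i. ((\<lambda>h. g h i) \<longlongrightarrow> x) (at 0)) \<and> (\<forall>h. \<bar>h\<bar> < d \<longrightarrow> rk_stages A f h x (g h))"
proof -
  define H :: "real^'n^'s \<Rightarrow> real^'n^'s"
    where "H G = (\<chi> i. \<Sum>j\<in>UNIV. A $ i $ j *\<^sub>R f (G $ j))" for G
  let ?c = "vec x :: real^'n^'s"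
  let ?K = "cball ?c 1"
  have contH: "continuous_on S H" for S
    unfolding H_def
    by (intro continuous_intros continuous_on_compose2[OF f]) auto
  have "bounded (H ` ?K)"
    by (intro compact_imp_bounded compact_continuous_image contH compact_cball)
  then obtain M where M: "M > 0" "\<And>G. G \<in> ?K \<Longrightarrow> norm (H G) \<le> M"
    unfolding bounded_pos by auto
  have ex: "\<exists>G. dist ?c G \<le> \<bar>h\<bar> * M \<and> ?c + h *\<^sub>R H G = G" if h: "\<bar>h\<bar> < 1 / M" for h
  proof -
    have le: "dist ?c (?c + h *\<^sub>R H G) \<le> \<bar>h\<bar> * M" if "G \<in> ?K" for G
      using M(2)[OF that] by (simp add: dist_norm mult_left_mono)
    have "\<bar>h\<bar> * M \<le> 1"
      using h M(1) by (simp add: field_simps)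
    then have maps: "(\<lambda>G. ?c + h *\<^sub>R H G) \<in> ?K \<rightarrow> ?K"
      using le by (fastforce simp del: dist_add_cancel dist_self)
    obtain G where "G \<in> ?K" "?c + h *\<^sub>R H G = G"
    proof (rule brouwer[OF _ _ _ _ maps])
      show "continuous_on ?K (\<lambda>G. ?c + h *\<^sub>R H G)"
        by (intro continuous_intros contH)
    qed auto
    then show ?thesis
      using le[of G] by auto
  qed
  then obtain G where G: "\<And>h. \<bar>h\<bar> < 1 / M \<Longrightarrow> dist ?c (G h) \<le> \<bar>h\<bar> * M \<and> ?c + h *\<^sub>R H (G h) = G h"
    by metis
  have "((\<lambda>h. G h $ i) \<longlongrightarrow> x) (at 0)" for i
  proof (rule Lim_transform_eventually[OF _ always_eventually])
    have "((\<lambda>h. dist (G h) ?c) \<longlongrightarrow> 0) (at 0)"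
    proof (rule tendsto_sandwich[of "\<lambda>_. 0"])
      show "\<forall>\<^sub>F h in at 0. dist (G h) ?c \<le> \<bar>h\<bar> * M"
        using G M(1) unfolding eventually_at
        by (intro exI[of _ "1 / M"]) (auto simp: dist_commute)
      show "((\<lambda>h. \<bar>h\<bar> * M) \<longlongrightarrow> 0) (at 0)"
        by (auto intro!: tendsto_eq_intros)
    qed auto
    then have "(G \<longlongrightarrow> ?c) (at 0)"
      by (simp add: tendsto_dist_iff[symmetric])
    then have "((\<lambda>h. G h $ i) \<longlongrightarrow> ?c $ i) (at 0)"
      by (rule tendsto_vec_nth)
    then show "((\<lambda>h. G h $ i) \<longlongrightarrow> x) (at 0)"
      by simp
  qed auto
  moreover have "rk_stages A f h x (\<lambda>i. G h $ i)" if "\<bar>h\<bar> < 1 / M" for h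
    unfolding rk_stages_def
  proof
    fix i
    have "G h $ i = (?c + h *\<^sub>R H (G h)) $ i"
      using G[OF that] by simp
    then show "G h $ i = x + h *\<^sub>R (\<Sum>j\<in>UNIV. A $ i $ j *\<^sub>R f (G h $ j))"
      by (simp add: H_def)
  qed
  ultimately show ?thesis
    using M(1) by (intro exI[of _ "1 / M"] conjI exI[of _ "\<lambda>h i. G h $ i"]) auto
qed

proposition is_rk_map_exists:
  fixes f :: "real^'n \<Rightarrow> real^'n" and A :: "real^'s^'s"
  assumes "polynomial_function f"
  shows "\<exists>\<delta> \<phi>. is_rk_map A b f \<delta> \<phi>"
proof -
  have "continuous_on UNIV f"
    using assms by (rule continuous_on_polymonial_function)
  from rk_stages_local[OF this, of _ A]
  obtain \<delta> g where g: "\<And>x. \<delta> x > 0" "\<And>x i. ((\<lambda>h. g x h i) \<longlongrightarrow> x) (at 0)"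
    "\<And>x h. \<bar>h\<bar> < \<delta> x \<Longrightarrow> rk_stages A f h x (g x h)"
    by metis
  show ?thesis
    unfolding is_rk_map_def
    using g
    by (intro exI[of _ \<delta>] exI[of _ "\<lambda>h x. x + h *\<^sub>R (\<Sum>j\<in>UNIV. b $ j *\<^sub>R f (g x h j))"]
        conjI exI[of _ "\<lambda>h x. g x h"]) auto
qed

end

theory Submission
  imports Defs
begin

text \<open>Let L be the linear part of the affine p, so that p(x + y) = p(x) + L y. The Darboux
  equation then reads L(f(x)) = lam * p(x). Each Runge-Kutta formula adds to x a linear combination
  of values of f, so p carries it to the same formula for the scalar test equation y' = lam * y
  (\<open>darboux_affine_form\<close> and the fact \<open>step\<close>). With z = lam * h, the
  values of p at the stages solve the linear system (I - z A) P = p(x) 1. Inverting the matrix and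
  inserting P into the update gives R(z) p(x).\<close>

text \<open>The derivative of an affine map is its linear part at every point, so the gradient is
  the constant coefficient vector and its pairing with f(x) is L(f(x)). Points are real and values
  lie in \<open>'k\<close>, so L is linear over the reals.\<close>

lemma darboux_affine_form:
  fixes f :: "real^'n \<Rightarrow> real^'n" and p :: "real^'n \<Rightarrow> 'k::real_normed_field"
  assumes "affine_polynomial p" and "darboux_polynomial f c p"
  obtains L where "linear L" "\<And>x y. p (x + y) = p x + L y" "\<And>x. L (f x) = c x * p x"
proof -
  obtain a d where p: "\<And>x. p x = a + (\<Sum>i\<in>UNIV. d $ i * of_real (x $ i))"
    using assms(1) unfolding affine_polynomial_def by auto
  define L where "L x = (\<Sum>i\<in>UNIV. d $ i * of_real (x $ i))" for x :: "real^'n"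
  have lin: "linear L"
    by (rule linearI)
       (simp_all add: L_def algebra_simps sum.distrib scaleR_conv_of_real[where 'a='k] sum_distrib_left)
  have der: "(p has_derivative L) (at x)" for x
  proof -
    have "p = (\<lambda>x. a + L x)"
      by (simp add: fun_eq_iff p L_def)
    moreover have "((\<lambda>x. a + L x) has_derivative L) (at x)"
      using has_derivative_add[OF has_derivative_const[of a] linear_imp_has_derivative[OF lin]]
      by simp
    ultimately show ?thesis by simp
  qed
  have "L (axis i 1) = d $ i" for i
    by (simp add: L_def axis_def if_distrib[of of_real] if_distrib[of "(*) _"] cong: if_cong)
  then have "gradient p x $ i = d $ i" for x i
    by (simp add: gradient_def frechet_derivative_at[OF der, symmetric])
  then have "L (f x) = c x * p x" for x
    using assms(2) by (simp add: darboux_polynomial_def L_def mult.commute)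
  moreover have "p (x + y) = p x + L y" for x y
    by (simp add: p L_def algebra_simps sum.distrib)
  ultimately show thesis
    using lin that by blast
qed

theorem corollary2:
  fixes f :: "real^'n \<Rightarrow> real^'n"
    and p :: "real^'n \<Rightarrow> 'k::real_normed_field"
    and lam :: 'k
    and A :: "real^'s^'s" and b :: "real^'s"
    and \<delta> :: "real^'n \<Rightarrow> real"
    and \<phi> :: "real \<Rightarrow> real^'n \<Rightarrow> real^'n"
  assumes "polynomial_function f"
    and "affine_polynomial p"
    and "darboux_polynomial f (\<lambda>_. lam) p"
    and "is_rk_map A b f \<delta> \<phi>"
  shows "\<forall>x h. \<bar>h\<bar> < \<delta> x \<and> invertible (rk_matrix A (lam * of_real h)) \<longrightarrow>
           p (\<phi> h x) = stability_function A b (lam * of_real h) * p x"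
proof (intro allI impI, elim conjE)
  fix x h
  assume h: "\<bar>h\<bar> < \<delta> x" and inv: "invertible (rk_matrix A (lam * of_real h))"
  let ?z = "lam * of_real h" and ?M = "rk_matrix A (lam * of_real h)"
  obtain L where L: "linear L" "\<And>x y. p (x + y) = p x + L y" "\<And>x. L (f x) = lam * p x"
    using darboux_affine_form[OF assms(2,3)] by blast
  from assms(4) obtain G where "\<And>x h. \<bar>h\<bar> < \<delta> x \<Longrightarrow> rk_stages A f h x (G h x) \<and>
      \<phi> h x = x + h *\<^sub>R (\<Sum>j\<in>UNIV. b $ j *\<^sub>R f (G h x j))"
    unfolding is_rk_map_def by blast
  from this[OF h] obtain g where g: "\<And>i. g i = x + h *\<^sub>R (\<Sum>j\<in>UNIV. A $ i $ j *\<^sub>R f (g j))"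
    and \<phi>: "\<phi> h x = x + h *\<^sub>R (\<Sum>j\<in>UNIV. b $ j *\<^sub>R f (g j))"
    unfolding rk_stages_def by blast
  \<comment> \<open>The weights are left arbitrary so that one identity serves both the stages (w a
    row of \<open>A\<close>) and the update (w = \<open>b\<close>).\<close>
  have step: "p (x + h *\<^sub>R (\<Sum>j\<in>UNIV. w j *\<^sub>R f (g j)))
      = p x + ?z * (\<Sum>j\<in>UNIV. of_real (w j) * p (g j))" for w :: "'s \<Rightarrow> real"
    by (simp add: L linear_scale[OF L(1)] linear_sum[OF L(1)]
        scaleR_conv_of_real[where 'a='k] sum_distrib_left ac_simps)
  define P where "P = (\<chi> i. p (g i))"
  \<comment> \<open>These are the stage equations after applying p, with the unknowns collected on
    the left.\<close>
  have "?M *v P = p x *s vec 1"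
  proof (rule vec_eq_iff[THEN iffD2], rule allI)
    fix i
    have "P $ i = p x + ?z * (\<Sum>j\<in>UNIV. of_real (A $ i $ j) * P $ j)"
      using step[of "\<lambda>j. A $ i $ j"] g[of i] by (simp add: P_def)
    moreover have "(?M *v P) $ i = P $ i - ?z * (\<Sum>j\<in>UNIV. of_real (A $ i $ j) * P $ j)"
      unfolding rk_matrix_def matrix_vector_mult_diff_rdistrib matrix_vector_mul_lid
      by (simp add: matrix_vector_mult_def map_matrix_def sum_distrib_left mult.assoc)
    ultimately show "(?M *v P) $ i = (p x *s vec 1) $ i"
      by simp
  qed
  then have "matrix_inv ?M *v (?M *v P) = p x *s (matrix_inv ?M *v vec 1)"
    by (simp add: vector_scalar_commute)
  \<comment> \<open>\<open>matrix_inv\<close> is defined by Hilbert choice; invertibility ensures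
    that the chosen matrix really is an inverse.\<close>
  moreover have "matrix_inv ?M ** ?M = mat 1"
    using someI_ex[OF inv[unfolded invertible_def]] by (simp add: matrix_inv_def)
  ultimately have P: "P = p x *s (matrix_inv ?M *v vec 1)"
    by (simp add: matrix_vector_mul_assoc)
  have "p (\<phi> h x) = p x + ?z * (\<Sum>j\<in>UNIV. of_real (b $ j) * P $ j)"
    using step[of "\<lambda>j. b $ j"] by (simp add: \<phi> P_def)
  also have "\<dots> = stability_function A b ?z * p x"
    \<comment> \<open>All stage values share the factor \<open>p x\<close>, which comes out of the
      sum and leaves R(z).\<close>
    by (subst P) (simp add: stability_function_def algebra_simps sum_distrib_left)
  finally show "p (\<phi> h x) = stability_function A b ?z * p x" .
qed

end
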